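(* Let $n\ge2$ be an integer. Every $a\in\mathbb{Z}$ with $a\ne0$ can be written as a finite $\circ_n$-product of $\circ_n$-irreducible elements of $n\mathrm{Ell}(\mathbb{Z})$. In particular, there are infinitely many $\circ_n$-irreducible elements in $n\mathrm{Ell}(\mathbb{Z})$.
   Context: $n\mathrm{Ell}(\mathbb{Z})$ is the set $\mathbb{Z}$ with the $n$-ary operation $a_1\ast\cdots\ast a_n:=1-\sum_{i=1}^n a_i$ and the commutative monoid operation $a\circ_n b:=a+b-(n+1)ab$ with identity $0$. A $\circ_n$-unit is an element invertible for $\circ_n$. A non-unit $p$ is $\circ_n$-irreducible if $p=a\circ_n b$ implies that $a$ or $b$ is a $\circ_n$-unit. *)

theory Defs
  imports "HOL-Algebra.Group"
begin

text \<open>The multiplicative part of the structure is a library monoid record, so that \<^const>\<open>Units\<close>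
  and \<^const>\<open>comm_monoid\<close> apply to it. An argument tuple of the additional operation is a function on
  indices; for an \<open>n\<close>-ary operation only its values at \<open>1, \<dots>, n\<close> matter.\<close>

record 'a nary_monoid = "'a monoid" +
  nary_op :: "(nat \<Rightarrow> 'a) \<Rightarrow> 'a"

definition nEll :: "nat \<Rightarrow> int nary_monoid" where
  "nEll n = \<lparr> carrier = UNIV,
              monoid.mult = (\<lambda>a b. a + b - (int n + 1) * a * b),
              one = 0,
              nary_op = (\<lambda>a. 1 - (\<Sum>i = 1..n. a i)) \<rparr>"

lemma nEll_simps [simp]:
  "carrier (nEll n) = UNIV"
  "a \<otimes>\<^bsub>nEll n\<^esub> b = a + b - (int n + 1) * a * b"
  "\<one>\<^bsub>nEll n\<^esub> = 0"
  "nary_op (nEll n) c = 1 - (\<Sum>i = 1..n. c i)"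
  by (simp_all add: nEll_def)

lemma nEll_comm_monoid: "comm_monoid (nEll n)"
  by (rule comm_monoidI) (simp_all add: algebra_simps)

text \<open>This is deliberately not the \<open>irreducible\<close> of \<open>HOL-Algebra.Divisibility\<close>, which is phrased
  via proper factors instead of via factorizations into two elements.\<close>

definition mult_irreducible :: "('a, 'b) monoid_scheme \<Rightarrow> 'a \<Rightarrow> bool" where
  "mult_irreducible G p \<longleftrightarrow>
     p \<in> carrier G \<and> p \<notin> Units G \<and>
     (\<forall>a\<in>carrier G. \<forall>b\<in>carrier G. p = a \<otimes>\<^bsub>G\<^esub> b \<longrightarrow> a \<in> Units G \<or> b \<in> Units G)"

definition mult_list :: "('a, 'b) monoid_scheme \<Rightarrow> 'a list \<Rightarrow> 'a" where
  "mult_list G ps = foldr (\<lambda>x y. x \<otimes>\<^bsub>G\<^esub> y) ps \<one>\<^bsub>G\<^esub>"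

end

theory Submission
  imports Defs
begin

text \<open>The operation satisfies \<open>1 - (n + 1)(a \<circ> b) = (1 - (n + 1) a)(1 - (n + 1) b)\<close>. So
  \<open>a \<mapsto> 1 - (n + 1) a\<close> identifies the monoid with the multiplicative monoid of the integers congruent
  to \<open>1\<close> modulo \<open>n + 1\<close>, and both claims are shown there.

  As \<open>n + 1 \<ge> 3\<close>, neither \<open>0\<close> nor \<open>-1\<close> is such an integer. Hence the identity is the only unit, every
  other element has absolute value at least \<open>2\<close>, and proper factors are strictly smaller in absolute
  value. Descent gives the factorizations (\<open>nEll_factorization\<close>).

  Infinitude is Euclid's argument: if \<open>P\<close> is the product of the images of finitely many
  irreducibles, then \<open>1 + (n + 1) P\<close> is again congruent to \<open>1\<close>, so it has an irreducible factor,
  which cannot divide \<open>P\<close>.\<close>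

definition residue_one :: "nat \<Rightarrow> int \<Rightarrow> int" where
  "residue_one n a = 1 - (int n + 1) * a"

lemma residue_one_mult:
  "residue_one n (a \<otimes>\<^bsub>nEll n\<^esub> b) = residue_one n a * residue_one n b"
  by (simp add: residue_one_def algebra_simps)

lemma residue_one_gt_1:
  assumes "n \<ge> 2" and "a \<noteq> 0"
  shows "\<bar>residue_one n a\<bar> > 1"
proof -
  have "3 * 1 \<le> (int n + 1) * \<bar>a\<bar>"
    using assms by (intro mult_mono) auto
  hence "\<bar>(int n + 1) * a\<bar> \<ge> 3"
    using assms by (simp add: abs_mult)
  thus ?thesis
    unfolding residue_one_def by linarith
qed

lemma Units_nEll:
  assumes "n \<ge> 2"
  shows "Units (nEll n) = {0}"
proof (intro equalityI subsetI)
  fix a assume "a \<in> Units (nEll n)"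
  then obtain b where "a \<otimes>\<^bsub>nEll n\<^esub> b = 0"
    unfolding Units_def by auto
  hence "residue_one n a * residue_one n b = 1"
    using residue_one_mult[of n a b] by (simp add: residue_one_def)
  hence "\<bar>residue_one n a\<bar> = 1"
    by (metis abs_zmult_eq_1 abs_one)
  with residue_one_gt_1[OF assms, of a] show "a \<in> {0}"
    by auto
qed (auto simp: Units_def)

text \<open>Descent on \<open>\<bar>1 - (n + 1) a\<bar>\<close>, which is multiplicative and exceeds \<open>1\<close> on every non-unit.\<close>

lemma nEll_factorization:
  assumes "n \<ge> 2" and "a \<noteq> 0"
  shows "\<exists>ps. (\<forall>p \<in> set ps. mult_irreducible (nEll n) p) \<and> a = mult_list (nEll n) ps"
  using assms(2)
proof (induction "nat \<bar>residue_one n a\<bar>" arbitrary: a rule: less_induct)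
  case less
  interpret comm_monoid "nEll n" by (rule nEll_comm_monoid)
  show ?case
  proof (cases "mult_irreducible (nEll n) a")
    case True
    thus ?thesis
      by (intro exI[of _ "[a]"]) (simp add: mult_list_def)
  next
    case False
    then obtain b c where a: "a = b \<otimes>\<^bsub>nEll n\<^esub> c" and "b \<noteq> 0" "c \<noteq> 0"
      using less.prems Units_nEll[OF assms(1)] unfolding mult_irreducible_def by auto
    define x y where "x = \<bar>residue_one n b\<bar>" and "y = \<bar>residue_one n c\<bar>"
    have xy: "x > 1" "y > 1" "\<bar>residue_one n a\<bar> = x * y"
      using residue_one_gt_1[OF assms(1)] \<open>b \<noteq> 0\<close> \<open>c \<noteq> 0\<close>
      unfolding a residue_one_mult x_def y_def by (auto simp: abs_mult)
    have "x * 1 < x * y" "1 * y < x * y"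
      using xy by (simp_all only: mult_less_cancel_left_pos mult_less_cancel_right_pos)
    hence "nat x < nat \<bar>residue_one n a\<bar>" "nat y < nat \<bar>residue_one n a\<bar>"
      using xy by auto
    then obtain ps qs where
      ps: "\<forall>p \<in> set ps. mult_irreducible (nEll n) p" "b = mult_list (nEll n) ps" and
      qs: "\<forall>p \<in> set qs. mult_irreducible (nEll n) p" "c = mult_list (nEll n) qs"
      using less.hyps[of b] less.hyps[of c] \<open>b \<noteq> 0\<close> \<open>c \<noteq> 0\<close> unfolding x_def y_def by blast
    have "mult_list (nEll n) (ps @ qs) = mult_list (nEll n) ps \<otimes>\<^bsub>nEll n\<^esub> mult_list (nEll n) qs"
    proof (induction ps)
      case Nil
      show ?case by (simp add: mult_list_def)
    next
      case (Cons p ps)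
      thus ?case
        using m_assoc[of p "mult_list (nEll n) ps" "mult_list (nEll n) qs"]
        by (simp add: mult_list_def del: nEll_simps(2))
    qed
    thus ?thesis
      using a ps qs by (intro exI[of _ "ps @ qs"]) auto
  qed
qed

lemma infinite_mult_irreducible_nEll:
  assumes "n \<ge> 2"
  shows "infinite {p. mult_irreducible (nEll n) p}" (is "infinite ?I")
proof
  assume fin: "finite ?I"
  have big: "\<bar>residue_one n p\<bar> > 1" if "p \<in> ?I" for p
    using that residue_one_gt_1[OF assms] Units_nEll[OF assms]
    by (auto simp: mult_irreducible_def)
  define P where "P = (\<Prod>p\<in>?I. residue_one n p)"
  have "P \<noteq> 0"
    unfolding P_def using fin big by fastforce
  \<comment> \<open>The image of \<open>-P\<close> is Euclid's number \<open>1 + (n + 1) P\<close>.\<close>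
  then obtain ps where ps: "\<forall>p \<in> set ps. mult_irreducible (nEll n) p" "- P = mult_list (nEll n) ps"
    using nEll_factorization[OF assms, of "- P"] by auto
  \<comment> \<open>The empty product is the identity \<open>0\<close>, so at least one factor occurs.\<close>
  with \<open>P \<noteq> 0\<close> obtain p qs where "ps = p # qs"
    by (cases ps) (auto simp: mult_list_def)
  hence p: "p \<in> ?I" and "- P = p \<otimes>\<^bsub>nEll n\<^esub> mult_list (nEll n) qs"
    using ps by (simp_all add: mult_list_def)
  hence "residue_one n p dvd residue_one n (- P)"
    by (metis residue_one_mult dvd_triv_left)
  hence "residue_one n p dvd 1 + (int n + 1) * P"
    by (simp add: residue_one_def)
  moreover have "residue_one n p dvd (int n + 1) * P"
    unfolding P_def using fin p by (intro dvd_mult dvd_prodI)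
  ultimately have "residue_one n p dvd 1"
    by (metis dvd_add_left_iff)
  with big[OF p] show False
    by simp
qed

theorem theorem7p1:
  fixes n :: nat
  assumes "n \<ge> 2"
  shows "(\<forall>a \<in> carrier (nEll n). a \<noteq> 0 \<longrightarrow>
            (\<exists>ps. (\<forall>p \<in> set ps. mult_irreducible (nEll n) p) \<and> a = mult_list (nEll n) ps))
         \<and> infinite {p. mult_irreducible (nEll n) p}"
  using nEll_factorization[OF assms] infinite_mult_irreducible_nEll[OF assms] by blast

end
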